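(* Let $f,g:\mathbb{R}^n\to\mathbb{R}\cup\{\infty\}$ be closed, proper, convex functions, let $\gamma>0$, $z^0\in\mathbb{R}^n$, and let $x^{k+1/2},x^{k+1},z^{k+1}$ ($k=0,1,\dots$) be the DRS iterates. Suppose $d^\star=p^\star=\infty$ and the primal problem (P) is infeasible. Then \[ \|x^{k+1}-x^{k+1/2}\|\to\mathrm{dist}(\mathrm{dom} f,\mathrm{dom} g). \]
   Context: A convex function is closed if its epigraph is closed, and proper if it is finite somewhere. $\mathrm{dom} f=\{x: f(x)<\infty\}$. $\mathrm{dist}(A,B)=\inf\{\|a-b\|: a\in A,\ b\in B\}$. $f^*(\nu)=\sup_x\{\langle \nu,x\rangle-f(x)\}$ is the convex conjugate. Primal problem (P): minimize $f(x)+g(x)$ over $x\in\mathbb{R}^n$, with optimal value $p^\star=\inf_x\{f(x)+g(x)\}\in[-\infty,\infty]$. It is infeasible if $\mathrm{dom} f\cap\mathrm{dom} g=\emptyset$ (in which case $p^\star=\infty$). Dual problem (D): maximize $-f^*(\nu)-g^*(-\nu)$ over $\nu\in\mathbb{R}^n$, with optimal value $d^\star=\sup_\nu\{-f^*(\nu)-g^*(-\nu)\}\in[-\infty,\infty]$. $\mathrm{Prox}_h(z)=\arg\min_x\{h(x)+\tfrac12\|x-z\|^2\}$. Douglas--Rachford splitting (DRS) with parameter $\gamma>0$ and starting point $z^0\in\mathbb{R}^n$: for $k=0,1,\dots$, $x^{k+1/2}=\mathrm{Prox}_{\gamma f}(z^k)$, $x^{k+1}=\mathrm{Prox}_{\gamma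 g}(2x^{k+1/2}-z^k)$, $z^{k+1}=z^k+x^{k+1}-x^{k+1/2}$. *)

theory Defs
  imports "HOL-Analysis.Analysis"
begin

text \<open>
  Functions into \<open>\<real> \<union> {\<infinity>}\<close> are modelled as \<^typ>\<open>ereal\<close>-valued functions; the predicate below
  excludes the value \<open>-\<infinity>\<close>.  Under it no sum in this theory has the form \<open>\<infinity> - \<infinity>\<close>, whose
  value in \<^typ>\<open>ereal\<close> is conventional; for the conjugates this also uses properness.
\<close>

definition never_minus_inf :: "('a \<Rightarrow> ereal) \<Rightarrow> bool" where
  "never_minus_inf f \<longleftrightarrow> (\<forall>x. f x \<noteq> -\<infinity>)"

definition proper_fun :: "('a \<Rightarrow> ereal) \<Rightarrow> bool" where
  "proper_fun f \<longleftrightarrow> (\<exists>x. \<bar>f x\<bar> \<noteq> \<infinity>)"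

text \<open>Since \<open>0 * \<infinity> = 0\<close> in \<^typ>\<open>ereal\<close>, the cases \<open>u = 0\<close> and \<open>v = 0\<close> hold trivially.\<close>

definition convex_fun :: "('a::real_vector \<Rightarrow> ereal) \<Rightarrow> bool" where
  "convex_fun f \<longleftrightarrow>
    (\<forall>x y. \<forall>u\<ge>0. \<forall>v\<ge>0. u + v = 1 \<longrightarrow>
      f (u *\<^sub>R x + v *\<^sub>R y) \<le> ereal u * f x + ereal v * f y)"

definition epi :: "('a \<Rightarrow> ereal) \<Rightarrow> ('a \<times> real) set" where
  "epi f = {(x, t). f x \<le> ereal t}"

definition closed_fun :: "('a::topological_space \<Rightarrow> ereal) \<Rightarrow> bool" where
  "closed_fun f \<longleftrightarrow> closed (epi f)"

definition eff_dom :: "('a \<Rightarrow> ereal) \<Rightarrow> 'a set" where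
  "eff_dom f = {x. f x < \<infinity>}"

definition conjugate :: "('a::real_inner \<Rightarrow> ereal) \<Rightarrow> 'a \<Rightarrow> ereal" where
  "conjugate f \<nu> = (SUP x. ereal (\<nu> \<bullet> x) - f x)"

definition primal_value :: "('a \<Rightarrow> ereal) \<Rightarrow> ('a \<Rightarrow> ereal) \<Rightarrow> ereal" where
  "primal_value f g = (INF x. f x + g x)"

definition dual_value :: "('a::real_inner \<Rightarrow> ereal) \<Rightarrow> ('a \<Rightarrow> ereal) \<Rightarrow> ereal" where
  "dual_value f g = (SUP \<nu>. - conjugate f \<nu> - conjugate g (- \<nu>))"

definition primal_infeasible :: "('a \<Rightarrow> ereal) \<Rightarrow> ('a \<Rightarrow> ereal) \<Rightarrow> bool" where
  "primal_infeasible f g \<longleftrightarrow> eff_dom f \<inter> eff_dom g = {}"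

text \<open>For closed proper convex \<open>h\<close> without the value \<open>-\<infinity>\<close> the minimizer exists and is unique,
  so the choice made by \<^const>\<open>arg_min\<close> is the minimizer.\<close>

definition prox :: "('a::real_normed_vector \<Rightarrow> ereal) \<Rightarrow> 'a \<Rightarrow> 'a" where
  "prox h z = (ARG_MIN (\<lambda>x. h x + ereal (1/2 * (norm (x - z))\<^sup>2)) x. True)"

text \<open>\<open>xh k\<close> is the half-step iterate $x^{k+1/2}$.  The value \<open>x 0\<close> is never used.\<close>

definition drs_iterates ::
  "('a::real_normed_vector \<Rightarrow> ereal) \<Rightarrow> ('a \<Rightarrow> ereal) \<Rightarrow> real \<Rightarrow> 'a
    \<Rightarrow> (nat \<Rightarrow> 'a) \<Rightarrow> (nat \<Rightarrow> 'a) \<Rightarrow> (nat \<Rightarrow> 'a) \<Rightarrow> bool" where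
  "drs_iterates f g \<gamma> z0 xh x z \<longleftrightarrow>
    z 0 = z0 \<and>
    (\<forall>k. xh k = prox (\<lambda>u. ereal \<gamma> * f u) (z k) \<and>
         x (Suc k) = prox (\<lambda>u. ereal \<gamma> * g u) (2 *\<^sub>R xh k - z k) \<and>
         z (Suc k) = z k + x (Suc k) - xh k)"

end

theory Submission
  imports Defs
begin

text \<open>
  Let \<open>A\<close> and \<open>B\<close> be the effective domains of \<open>f\<close> and \<open>g\<close>, let \<open>\<delta> k = z (Suc k) - z k\<close> be the
  difference of the two proximal points of iteration \<open>k\<close>, and let \<open>v\<close> be the point of the closure
  of \<open>B - A\<close> nearest to the origin.  Since \<open>\<delta> k\<close> lies in \<open>B - A\<close>, its norm is never below
  \<open>setdist A B\<close>; the work is in the upper bound.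

  The iteration \<open>z k \<mapsto> z (Suc k)\<close> is firmly nonexpansive.  Hence \<open>norm (\<delta> k)\<close> decreases to some
  limit \<open>L\<close>, and the difference of consecutive steps tends to \<open>0\<close>.  Nonexpansiveness then gives
  \<open>j * L \<le> norm (z j - z 0)\<close> for every \<open>j\<close> (\<open>limit_le_average_speed\<close>), so that
  only the average speed \<open>norm (z j - z 0) / j\<close> has to be bounded.

  This is where the dual problem enters.  As its value is \<open>\<infinity>\<close>, some \<open>\<nu>\<close> is dual feasible, and
  \<open>f\<close> and \<open>g\<close> have affine minorants with the opposite slopes \<open>\<nu>\<close> and \<open>- \<nu>\<close>.  Adding the
  subgradient inequalities of the two proximal steps at points of \<open>A\<close> and \<open>B\<close> whose difference is
  nearly \<open>v\<close> then yields \<open>z k \<bullet> (\<delta> k - v) \<le> C + e * k\<close> for arbitrarily small \<open>e > 0\<close>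
  (\<open>inner_step_minus_gap_le\<close>).  As \<open>v \<bullet> (\<delta> k - v) \<ge> 0\<close>, this makes the squared
  norm of \<open>z k - k *\<^sub>R v\<close> grow slower than \<open>k\<^sup>2\<close>, so the average speed tends to \<open>norm v\<close>
  (\<open>average_displacement_tendsto_gap\<close>), which is at most \<open>setdist A B\<close>.

  The minorants also make the proximal objectives coercive, so their minimizers exist.
\<close>

section \<open>The proximal map of a function with an affine minorant\<close>

lemma proper_fun_finite_value:
  assumes "proper_fun f"
  shows "\<exists>x c. f x = ereal c"
proof -
  obtain x where "\<bar>f x\<bar> \<noteq> \<infinity>" using assms unfolding proper_fun_def by (elim exE)
  then have "\<exists>c. f x = ereal c" by (cases "f x") auto
  then show ?thesis by blast
qed

text \<open>
  The function need not be continuous, but its epigraph is closed.  So the objective is minimized as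
  the continuous function \<open>\<phi>\<close> on a sublevel set inside the epigraph, which is compact because
  the quadratic term dominates the affine minorant.
\<close>

lemma proximal_minimizer_exists:
  fixes h :: "'a::euclidean_space \<Rightarrow> ereal"
  assumes "closed_fun h" "never_minus_inf h" "proper_fun h"
    and minorant: "\<And>x. ereal (\<nu> \<bullet> x - a) \<le> h x"
  shows "\<exists>p. \<forall>y. h p + ereal (1/2 * (norm (p - z))\<^sup>2) \<le> h y + ereal (1/2 * (norm (y - z))\<^sup>2)"
proof -
  obtain x0 c0 where x0: "h x0 = ereal c0"
    using proper_fun_finite_value[OF assms(3)] by blast
  define \<phi> where "\<phi> = (\<lambda>(x, t). t + 1/2 * (norm (x - z))\<^sup>2)"
  define c where "c = \<phi> (x0, c0)"
  define K where "K = epi h \<inter> {xt. \<phi> xt \<le> c}"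
  have cont: "continuous_on S \<phi>" for S
    unfolding \<phi>_def case_prod_beta by (intro continuous_intros)
  have "closed K"
    using assms(1) closed_Collect_le[OF cont[of UNIV] continuous_on_const[of UNIV c]]
    unfolding K_def closed_fun_def by blast
  moreover have "bounded K"
  proof -
    define n where "n = norm \<nu>"
    define E where "E = \<bar>c + a - \<nu> \<bullet> z\<bar>"
    define R where "R = 2 * n + 2 * E + 1"
    have "x \<in> cball z R \<and> t \<in> {- (n * R) + \<nu> \<bullet> z - a .. c}" if "(x, t) \<in> K" for x t
    proof -
      define r where "r = norm (x - z)"
      have r0: "0 \<le> r" "0 \<le> n" "0 \<le> E" by (auto simp: r_def n_def E_def)
      have 1: "\<nu> \<bullet> x - a \<le> t"
        using that minorant[of x] order_trans by (fastforce simp: K_def epi_def)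
      have 2: "t + 1/2 * r\<^sup>2 \<le> c"
        using that by (simp add: K_def \<phi>_def r_def)
      have 3: "\<bar>\<nu> \<bullet> (x - z)\<bar> \<le> n * r"
        unfolding n_def r_def by (rule Cauchy_Schwarz_ineq2)
      then have "- (\<nu> \<bullet> (x - z)) \<le> n * r" by linarith
      moreover have "r * r = 2 * (1/2 * r\<^sup>2)" by (simp add: power2_eq_square)
      moreover have "c + a - \<nu> \<bullet> z \<le> E" unfolding E_def by simp
      moreover have "\<nu> \<bullet> x = \<nu> \<bullet> (x - z) + \<nu> \<bullet> z" by (simp add: inner_diff_right)
      ultimately have 4: "r * r \<le> 2 * E + 2 * (n * r)"
        using 1 2 by argo
      \<comment> \<open>A solution of \<open>r\<^sup>2 \<le> 2 * E + 2 * n * r\<close> with \<open>r \<ge> 1\<close> satisfies \<open>r \<le> 2 * E + 2 * n\<close>.\<close>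
      have "r \<le> R"
      proof (rule ccontr)
        assume "\<not> r \<le> R"
        then have "1 \<le> r" "2 * n + 2 * E < r" using r0 by (auto simp: R_def)
        then have "(2 * n + 2 * E) * r < r * r" by (intro mult_strict_right_mono) auto
        moreover have "2 * E * 1 \<le> 2 * E * r"
          using \<open>1 \<le> r\<close> r0 by (intro mult_left_mono) auto
        ultimately show False using 4 by (auto simp: algebra_simps)
      qed
      moreover have "n * r \<le> n * R"
        using \<open>r \<le> R\<close> r0 by (intro mult_left_mono) auto
      moreover have "t \<le> c" using 2 zero_le_power2[of r] by linarith
      ultimately show ?thesis
        using 1 3 by (auto simp: r_def dist_norm norm_minus_commute inner_diff_right)
    qed
    then have "K \<subseteq> cball z R \<times> {- (n * R) + \<nu> \<bullet> z - a .. c}" by auto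
    then show ?thesis
      by (rule bounded_subset[rotated]) (intro bounded_Times bounded_cball bounded_closed_interval)
  qed
  ultimately have "compact K" by (simp add: compact_eq_bounded_closed)
  moreover have "(x0, c0) \<in> K" by (simp add: K_def epi_def x0 c_def)
  ultimately obtain m where m: "m \<in> K" "\<And>y. y \<in> K \<Longrightarrow> \<phi> m \<le> \<phi> y"
    using continuous_attains_inf[OF _ _ cont, of K] by blast
  obtain p t where pt: "m = (p, t)" by fastforce
  have hp: "h p \<le> ereal t" and mc: "\<phi> m \<le> c" using m pt by (auto simp: K_def epi_def)
  have "h p + ereal (1/2 * (norm (p - z))\<^sup>2) \<le> h y + ereal (1/2 * (norm (y - z))\<^sup>2)" for y
  proof (cases "h y")
    case (real s)
    have "\<phi> m \<le> \<phi> (y, s)"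
      using m(2)[of "(y, s)"] mc real by (cases "\<phi> (y, s) \<le> c") (auto simp: K_def epi_def)
    then have le: "ereal (t + 1/2 * (norm (p - z))\<^sup>2) \<le> h y + ereal (1/2 * (norm (y - z))\<^sup>2)"
      by (simp add: \<phi>_def pt real)
    have "h p + ereal (1/2 * (norm (p - z))\<^sup>2) \<le> ereal (t + 1/2 * (norm (p - z))\<^sup>2)"
      using add_right_mono[OF hp] by (metis plus_ereal.simps(1))
    then show ?thesis using le by (rule order_trans)
  qed (use assms(2) in \<open>auto simp: never_minus_inf_def\<close>)
  then show ?thesis by blast
qed

text \<open>
  Comparing the minimal value at \<open>p\<close> with the value at \<open>p + s *\<^sub>R (u - p)\<close> and letting \<open>s\<close> tend
  to \<open>0\<close> shows that \<open>z - p\<close> is a subgradient of \<open>h\<close> at \<open>p\<close>.  All later facts about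
  the orbit rest on this inequality and on \<open>p\<close> lying in the effective domain.
\<close>

lemma prox_variational_inequality:
  fixes h :: "'a::euclidean_space \<Rightarrow> ereal"
  assumes "closed_fun h" "never_minus_inf h" "proper_fun h" "convex_fun h"
    and minorant: "\<And>x. ereal (\<nu> \<bullet> x - a) \<le> h x"
  shows "prox h z \<in> eff_dom h" (is ?dom)
    and "u \<in> eff_dom h \<Longrightarrow>
      real_of_ereal (h (prox h z)) + (z - prox h z) \<bullet> (u - prox h z) \<le> real_of_ereal (h u)"
      (is "_ \<Longrightarrow> ?ineq")
proof -
  define p where "p = prox h z"
  let ?\<phi> = "\<lambda>x. h x + ereal (1/2 * (norm (x - z))\<^sup>2)"
  obtain p' where p': "\<forall>y. ?\<phi> p' \<le> ?\<phi> y"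
    using proximal_minimizer_exists[OF assms(1,2,3) minorant] by blast
  then have "is_arg_min ?\<phi> (\<lambda>_. True) p'"
    by (simp add: is_arg_min_def not_less)
  then have "is_arg_min ?\<phi> (\<lambda>_. True) p"
    unfolding p_def prox_def arg_min_def by (rule someI)
  then have min: "?\<phi> p \<le> ?\<phi> y" for y
    by (simp add: is_arg_min_def not_less)
  obtain x0 c0 where x0: "h x0 = ereal c0"
    using proper_fun_finite_value[OF assms(3)] by blast
  have "h p \<noteq> \<infinity>" using min[of x0] x0 by auto
  then show ?dom by (simp add: eff_dom_def p_def less_top[symmetric] top_ereal_def)
  from \<open>h p \<noteq> \<infinity>\<close> obtain hp where hp: "h p = ereal hp"
    using assms(2) unfolding never_minus_inf_def by (cases "h p") auto
  assume "u \<in> eff_dom h"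
  then obtain hu where hu: "h u = ereal hu"
    using assms(2) unfolding never_minus_inf_def eff_dom_def by (cases "h u") auto
  have key: "(z - p) \<bullet> (u - p) - (hu - hp) \<le> s * (1/2 * (norm (u - p))\<^sup>2)" if s: "0 < s" "s < 1" for s
  proof -
    define y where "y = (1 - s) *\<^sub>R p + s *\<^sub>R u"
    have "h y \<le> ereal ((1 - s) * hp + s * hu)"
      using assms(4)[unfolded convex_fun_def, rule_format, of "1 - s" s p u] s
      by (simp add: y_def hp hu)
    from order_trans[OF min[of y] add_right_mono, OF this]
    have "ereal (hp + 1/2 * (norm (p - z))\<^sup>2)
        \<le> ereal ((1 - s) * hp + s * hu) + ereal (1/2 * (norm (y - z))\<^sup>2)"
      by (simp add: hp)
    then have 1: "hp + 1/2 * (norm (p - z))\<^sup>2 \<le> (1 - s) * hp + s * hu + 1/2 * (norm (y - z))\<^sup>2"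
      by simp
    have yz: "y - z = (p - z) + s *\<^sub>R (u - p)" by (simp add: y_def algebra_simps)
    have "(norm (y - z))\<^sup>2
        = (norm (p - z))\<^sup>2 + 2 * s * ((p - z) \<bullet> (u - p)) + s * s * (norm (u - p))\<^sup>2"
      unfolding yz power2_norm_eq_inner
      by (simp only: inner_add_left inner_add_right inner_scaleR_left inner_scaleR_right
          algebra_simps) (simp add: inner_commute)
    with 1 have "s * ((z - p) \<bullet> (u - p) - (hu - hp)) \<le> s * (s * (1/2 * (norm (u - p))\<^sup>2))"
      by (simp add: algebra_simps inner_diff_left)
    then show ?thesis using s by simp
  qed
  have "(z - p) \<bullet> (u - p) - (hu - hp) \<le> 0"
  proof (rule tendsto_lowerbound)
    show "((\<lambda>s. s * (1/2 * (norm (u - p))\<^sup>2)) \<longlongrightarrow> 0) (at_right 0)"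
      by (auto intro!: tendsto_eq_intros)
    show "\<forall>\<^sub>F s in at_right 0. (z - p) \<bullet> (u - p) - (hu - hp) \<le> s * (1/2 * (norm (u - p))\<^sup>2)"
      unfolding eventually_at_right_field using key by (intro exI[of _ 1]) auto
  qed simp
  then show ?ineq using hp hu by (simp add: p_def)
qed

section \<open>Orbits of the splitting operator\<close>

text \<open>
  An orbit is described by real-valued functions on the domains and the subgradient inequalities
  of its proximal steps.  The scaling by the step size is absorbed into \<open>F\<close>, \<open>G\<close> and their minorants.
\<close>

locale splitting_orbit =
  fixes A B :: "'a::euclidean_space set" and F G :: "'a \<Rightarrow> real"
    and \<nu> :: 'a and a b :: real and z p q :: "nat \<Rightarrow> 'a"
  assumes convex_A: "convex A" and convex_B: "convex B"
    and p_mem: "\<And>k. p k \<in> A" and q_mem: "\<And>k. q k \<in> B"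
    and z_Suc: "\<And>k. z (Suc k) = z k + (q k - p k)"
    and subgradient_F: "\<And>k u. u \<in> A \<Longrightarrow> F (p k) + (z k - p k) \<bullet> (u - p k) \<le> F u"
    and subgradient_G: "\<And>k w. w \<in> B \<Longrightarrow> G (q k) + (2 *\<^sub>R p k - z k - q k) \<bullet> (w - q k) \<le> G w"
    and minorant_F: "\<And>u. u \<in> A \<Longrightarrow> \<nu> \<bullet> u - a \<le> F u"
    and minorant_G: "\<And>w. w \<in> B \<Longrightarrow> - (\<nu> \<bullet> w) - b \<le> G w"
begin

definition \<delta> :: "nat \<Rightarrow> 'a" where
  "\<delta> k = q k - p k"

lemma orbit_monotone_F: "0 \<le> ((z k - z j) - (p k - p j)) \<bullet> (p k - p j)"
  using subgradient_F[OF p_mem, of k j] subgradient_F[OF p_mem, of j k]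
  by (simp add: inner_diff_left inner_diff_right inner_commute)

lemma orbit_monotone_G: "0 \<le> (2 *\<^sub>R (p k - p j) - (z k - z j) - (q k - q j)) \<bullet> (q k - q j)"
  using subgradient_G[OF q_mem, of k j] subgradient_G[OF q_mem, of j k]
  by (simp add: algebra_simps inner_diff_left inner_diff_right inner_commute)

text \<open>
  This is firm nonexpansiveness of the map from \<open>z k\<close> to \<open>z (Suc k)\<close>.
  The inner product is exactly the sum of the two monotonicity expressions above.
\<close>

lemma orbit_firmly_nonexpansive:
  "0 \<le> (z (Suc k) - z (Suc j)) \<bullet> ((z k - z j) - (z (Suc k) - z (Suc j)))"
  using orbit_monotone_F[of k j] orbit_monotone_G[of k j]
  by (simp add: z_Suc algebra_simps inner_diff_left inner_diff_right inner_add_left inner_add_right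
      inner_commute)

lemma norm_le_if_inner_diff_nonneg:
  fixes c d :: 'a
  assumes "0 \<le> d \<bullet> (c - d)"
  shows "norm d \<le> norm c"
proof -
  have "norm d * norm d \<le> norm c * norm d"
    using assms norm_cauchy_schwarz[of d c]
    by (simp add: inner_diff_right dot_square_norm power2_eq_square mult.commute)
  then show ?thesis by (cases "norm d = 0") auto
qed

lemma orbit_nonexpansive: "norm (z (k + j) - z (k + i)) \<le> norm (z j - z i)"
proof (induction k)
  case (Suc k)
  have "norm (z (Suc (k + j)) - z (Suc (k + i))) \<le> norm (z (k + j) - z (k + i))"
    by (rule norm_le_if_inner_diff_nonneg, rule orbit_firmly_nonexpansive)
  with Suc show ?case by simp
qed simp

lemma z_step: "z (Suc k) - z k = \<delta> k"
  by (simp add: z_Suc \<delta>_def)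

lemma norm_\<delta>_decseq: "decseq (\<lambda>k. norm (\<delta> k))"
  unfolding decseq_Suc_iff
  using orbit_nonexpansive[of 1 "Suc k" k for k] by (simp add: z_step)

lemma norm_\<delta>_le: "norm (\<delta> k) \<le> norm (\<delta> 0)"
  using decseqD[OF norm_\<delta>_decseq] by blast

lemma norm_z_le: "norm (z k - z 0) \<le> k * norm (\<delta> 0)"
proof (induction k)
  case (Suc k)
  have "z (Suc k) - z 0 = (z k - z 0) + \<delta> k" by (simp add: z_step[symmetric])
  then have "norm (z (Suc k) - z 0) \<le> norm (z k - z 0) + norm (\<delta> k)"
    by (metis norm_triangle_ineq)
  with Suc norm_\<delta>_le[of k] show ?case by (simp add: algebra_simps)
qed simp

lemma norm_p_le: "norm (p k - p 0) \<le> k * norm (\<delta> 0)"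
proof -
  have "norm (p k - p 0) \<le> norm (z k - z 0)"
    using orbit_monotone_F[of k 0]
    by (intro norm_le_if_inner_diff_nonneg) (simp add: inner_commute)
  with norm_z_le[of k] show ?thesis by simp
qed

subsection \<open>The limit of the step lengths is at most any average speed\<close>

text \<open>
  Firm nonexpansiveness bounds the squared norm of an increment by the decrease of
  \<open>(norm (\<delta> k))\<^sup>2\<close>, which converges.
\<close>

lemma \<delta>_increments_tendsto_0: "(\<lambda>k. \<delta> (Suc k) - \<delta> k) \<longlonglongrightarrow> 0"
proof -
  let ?n = "\<lambda>k. (norm (\<delta> k))\<^sup>2"
  obtain L where "(\<lambda>k. norm (\<delta> k)) \<longlonglongrightarrow> L"
    using decseq_convergent[OF norm_\<delta>_decseq, of 0] by auto
  then have "?n \<longlonglongrightarrow> L\<^sup>2" by (intro tendsto_intros)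
  then have lim: "(\<lambda>k. ?n k - ?n (Suc k)) \<longlonglongrightarrow> L\<^sup>2 - L\<^sup>2"
    by (intro tendsto_diff LIMSEQ_Suc)
  have le: "(norm (\<delta> (Suc k) - \<delta> k))\<^sup>2 \<le> ?n k - ?n (Suc k)" for k
    using orbit_firmly_nonexpansive[of "Suc k" k]
    by (simp add: z_step power2_norm_eq_inner inner_diff_left inner_diff_right inner_commute)
  have "(\<lambda>k. (norm (\<delta> (Suc k) - \<delta> k))\<^sup>2) \<longlonglongrightarrow> 0"
  proof (rule tendsto_sandwich[OF _ _ tendsto_const])
    show "(\<lambda>k. ?n k - ?n (Suc k)) \<longlonglongrightarrow> 0" using lim by (simp only: diff_self)
    show "\<forall>\<^sub>F k in sequentially. (norm (\<delta> (Suc k) - \<delta> k))\<^sup>2 \<le> ?n k - ?n (Suc k)"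
      by (rule always_eventually, rule allI, rule le)
  qed simp
  then have "(\<lambda>k. norm (\<delta> (Suc k) - \<delta> k)) \<longlonglongrightarrow> 0"
    using tendsto_real_sqrt by fastforce
  then show ?thesis
    by (rule tendsto_norm_zero_cancel)
qed

text \<open>
  The difference of consecutive steps tends to \<open>0\<close>, so for large \<open>k\<close> the displacement over \<open>j\<close> steps is close to
  \<open>j\<close> times a single step; by nonexpansiveness it is no longer than the first such displacement.
\<close>

lemma limit_le_average_speed:
  assumes L: "(\<lambda>k. norm (\<delta> k)) \<longlonglongrightarrow> L"
  shows "j * L \<le> norm (z j - z 0)"
proof -
  have shift: "(\<lambda>k. \<delta> (k + i) - \<delta> k) \<longlonglongrightarrow> 0" for i
  proof (induction i)
    case (Suc i)
    have "(\<lambda>k. (\<delta> (Suc (k + i)) - \<delta> (k + i)) + (\<delta> (k + i) - \<delta> k)) \<longlonglongrightarrow> 0 + 0"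
      using LIMSEQ_ignore_initial_segment[OF \<delta>_increments_tendsto_0, of i] Suc
      by (intro tendsto_add) auto
    then show ?case by simp
  qed simp
  define e where "e j k = z (k + j) - z k - real j *\<^sub>R \<delta> k" for j k
  have e0: "e j \<longlonglongrightarrow> 0"
  proof (induction j)
    case (Suc j)
    have "e (Suc j) = (\<lambda>k. e j k + (\<delta> (k + j) - \<delta> k))"
    proof
      show "e (Suc j) k = e j k + (\<delta> (k + j) - \<delta> k)" for k
        using z_step[of "k + j"] by (simp add: e_def algebra_simps)
    qed
    then show ?case using tendsto_add[OF Suc shift[of j]] by simp
  qed (simp add: e_def)
  have bound: "j * norm (\<delta> k) \<le> norm (z j - z 0) + norm (e j k)" for k
  proof -
    have "real j *\<^sub>R \<delta> k = (z (k + j) - z (k + 0)) - e j k" by (simp add: e_def)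
    then have "j * norm (\<delta> k) \<le> norm (z (k + j) - z (k + 0)) + norm (e j k)"
      by (metis norm_scaleR norm_triangle_ineq4 abs_of_nat)
    with orbit_nonexpansive[of k j 0] show ?thesis by simp
  qed
  have "(\<lambda>k. j * norm (\<delta> k)) \<longlonglongrightarrow> j * L" using L by (intro tendsto_intros)
  moreover have "(\<lambda>k. norm (z j - z 0) + norm (e j k)) \<longlonglongrightarrow> norm (z j - z 0) + 0"
    by (intro tendsto_intros tendsto_norm_zero e0)
  ultimately show ?thesis
    using LIMSEQ_le bound by fastforce
qed

subsection \<open>The average speed is the gap between the sets\<close>

text \<open>The point of the closure of \<open>B - A\<close> nearest to the origin.\<close>

definition gap :: 'a where
  "gap = closest_point (closure (\<Union>w\<in>B. \<Union>u\<in>A. {w - u})) 0"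

lemma gap_mem: "gap \<in> closure (\<Union>w\<in>B. \<Union>u\<in>A. {w - u})"
proof -
  have "q 0 - p 0 \<in> closure (\<Union>w\<in>B. \<Union>u\<in>A. {w - u})"
    using p_mem q_mem closure_subset by fastforce
  then have "closure (\<Union>w\<in>B. \<Union>u\<in>A. {w - u}) \<noteq> {}"
    by (metis empty_iff)
  then show ?thesis
    unfolding gap_def by (intro closest_point_in_set closed_closure)
qed

lemma gap_supports:
  assumes "u \<in> A" "w \<in> B"
  shows "(norm gap)\<^sup>2 \<le> gap \<bullet> (w - u)"
proof -
  let ?D = "\<Union>w\<in>B. \<Union>u\<in>A. {w - u}"
  have "w - u \<in> closure ?D" using assms closure_subset by fastforce
  moreover have "convex (closure ?D)"
    by (intro convex_closure convex_differences convex_A convex_B)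
  ultimately have "(0 - gap) \<bullet> ((w - u) - gap) \<le> 0"
    unfolding gap_def by (intro closest_point_dot) auto
  then show ?thesis by (simp add: inner_diff_right power2_norm_eq_inner)
qed

lemma norm_gap_le_setdist: "norm gap \<le> setdist A B"
proof (rule le_setdistI)
  fix u w assume "u \<in> A" "w \<in> B"
  then have "w - u \<in> closure (\<Union>w\<in>B. \<Union>u\<in>A. {w - u})"
    using closure_subset by fastforce
  then have "dist 0 gap \<le> dist 0 (w - u)"
    unfolding gap_def by (intro closest_point_le) auto
  then show "norm gap \<le> dist u w" by (simp add: dist_norm norm_minus_commute)
qed (use p_mem q_mem in auto)

text \<open>
  Add the two subgradient inequalities at points \<open>u\<close> and \<open>w\<close> whose difference is nearly the gap.
  The minorants bound \<open>F (p k) + G (q k)\<close> below in terms of the step \<open>\<delta> k\<close> alone, because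
  their slopes are opposite, and \<open>gap_supports\<close> bounds \<open>gap \<bullet> q k\<close>, hence also
  \<open>gap \<bullet> p k = gap \<bullet> q k - gap \<bullet> \<delta> k\<close>, below.  The only terms that can grow with \<open>k\<close> come from replacing \<open>w - u\<close> by the gap, and these are small
  multiples of \<open>k\<close>, since \<open>z\<close> and \<open>p\<close> grow at most linearly.
\<close>

lemma inner_step_minus_gap_le:
  fixes e :: real
  assumes "0 < e"
  shows "\<exists>C. \<forall>k. z k \<bullet> (\<delta> k - gap) \<le> C + e * k"
proof -
  define D where "D = norm (\<delta> 0)"
  \<comment> \<open>\<open>norm (z k - p k)\<close> grows with slope at most \<open>2 * D\<close>; the added \<open>1\<close> avoids dividing by zero.\<close>
  define \<epsilon> where "\<epsilon> = e / (2 * D + 1)"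
  have D0: "0 \<le> D" and \<epsilon>: "0 < \<epsilon>" "\<epsilon> * (2 * D) \<le> e"
    using assms by (auto simp: D_def \<epsilon>_def field_simps add_pos_nonneg)
  obtain u w where u: "u \<in> A" and w: "w \<in> B" and near: "norm (w - u - gap) < \<epsilon>"
    using gap_mem \<epsilon>(1) unfolding closure_approachable dist_norm by fast
  define r where "r = w - u - gap"
  define C where "C = F u + G w + a + b + D * norm \<nu> - gap \<bullet> p 0 + D * norm gap
    + D * norm u + D * norm (w - u) + \<epsilon> * norm (z 0 - p 0)"
  have "z k \<bullet> (\<delta> k - gap) \<le> C + e * k" for k
  proof -
    note \<delta>_bound = norm_\<delta>_le[of k, folded D_def]
    have "norm (\<delta> k) * norm y \<le> D * norm y" for y :: 'a
      using \<delta>_bound by (intro mult_right_mono) auto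
    then have CS: "\<delta> k \<bullet> y \<le> D * norm y" for y
      using norm_cauchy_schwarz[of "\<delta> k" y] order_trans by blast
    have "z k - p k = (z 0 - p 0) + ((z k - z 0) - (p k - p 0))" by simp
    then have "norm (z k - p k) \<le> norm (z 0 - p 0) + norm ((z k - z 0) - (p k - p 0))"
      by (metis norm_triangle_ineq)
    also have "\<dots> \<le> norm (z 0 - p 0) + 2 * D * k"
      using norm_triangle_ineq4[of "z k - z 0" "p k - p 0"] norm_z_le[of k] norm_p_le[of k]
      by (simp add: D_def algebra_simps)
    finally have zp: "norm (z k - p k) \<le> norm (z 0 - p 0) + 2 * D * k" .
    have "(z k - p k) \<bullet> r \<le> norm (z k - p k) * norm r"
      by (rule norm_cauchy_schwarz)
    also have "\<dots> \<le> (norm (z 0 - p 0) + 2 * D * k) * \<epsilon>"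
      using zp near by (intro mult_mono) (auto simp: r_def D0)
    also have "\<dots> \<le> \<epsilon> * norm (z 0 - p 0) + e * k"
      using mult_right_mono[OF \<epsilon>(2), of "real k"] by (simp add: algebra_simps)
    finally have small: "(z k - p k) \<bullet> r \<le> \<epsilon> * norm (z 0 - p 0) + e * k" .
    have "0 \<le> (norm gap)\<^sup>2" by simp
    then have "0 \<le> gap \<bullet> (q k - p 0)"
      using gap_supports[OF p_mem[of 0] q_mem[of k]] by linarith
    then have "- (gap \<bullet> p k) \<le> \<delta> k \<bullet> gap - gap \<bullet> p 0"
      by (simp add: \<delta>_def inner_diff_right inner_diff_left inner_commute)
    then have low: "- (gap \<bullet> p k) \<le> D * norm gap - gap \<bullet> p 0"
      using CS[of gap] by linarith
    have q: "q k = p k + \<delta> k" by (simp add: \<delta>_def)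
    have wr: "w = u + gap + r" by (simp add: r_def)
    have "z k \<bullet> (\<delta> k - gap) \<le> F u + G w + a + b + \<delta> k \<bullet> \<nu> - gap \<bullet> p k
        + \<delta> k \<bullet> u + \<delta> k \<bullet> (w - u) - \<delta> k \<bullet> \<delta> k + (z k - p k) \<bullet> r"
      using subgradient_F[OF u, of k] subgradient_G[OF w, of k]
        minorant_F[OF p_mem, of k] minorant_G[OF q_mem, of k]
      unfolding q wr
      by (simp add: algebra_simps inner_add_left inner_add_right inner_diff_left inner_diff_right
          inner_commute)
    moreover have "0 \<le> \<delta> k \<bullet> \<delta> k" by simp
    ultimately show ?thesis
      using small low CS[of \<nu>] CS[of u] CS[of "w - u"] unfolding C_def
      by linarith
  qed
  then show ?thesis by blast
qed

text \<open>
  The drift \<open>z k - k *\<^sub>R gap\<close> has squared norm \<open>o(k\<^sup>2)\<close>: the cross term of each increment is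
  controlled by the preceding bound, as \<open>gap \<bullet> (\<delta> k - gap)\<close> is nonnegative.
\<close>

lemma average_displacement_tendsto_gap: "(\<lambda>k. norm (z k - real k *\<^sub>R gap) / k) \<longlonglongrightarrow> 0"
proof -
  define y where "y k = z k - real k *\<^sub>R gap" for k
  define M where "M = (norm (\<delta> 0) + norm gap)\<^sup>2"
  have quadratic: "\<exists>C. \<forall>k. (norm (y k))\<^sup>2 \<le> (norm (z 0))\<^sup>2 + C * real k + e * (real k)\<^sup>2" if "0 < e" for e :: real
  proof -
    obtain C where C: "\<And>k. z k \<bullet> (\<delta> k - gap) \<le> C + e * k"
      using inner_step_minus_gap_le[OF \<open>0 < e\<close>] by blast
    have "(norm (y k))\<^sup>2 \<le> (norm (z 0))\<^sup>2 + (2 * C + M) * k + e * (real k)\<^sup>2" for k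
    proof (induction k)
      case 0 show ?case by (simp add: y_def)
    next
      case (Suc k)
      have "y (Suc k) = y k + (\<delta> k - gap)"
        using z_step[of k] by (simp add: y_def algebra_simps)
      then have "(norm (y (Suc k)))\<^sup>2
          = (norm (y k))\<^sup>2 + 2 * (y k \<bullet> (\<delta> k - gap)) + (norm (\<delta> k - gap))\<^sup>2"
        by (simp add: power2_norm_eq_inner inner_add_left inner_add_right inner_commute)
      moreover have "0 \<le> gap \<bullet> (\<delta> k - gap)"
        using gap_supports[OF p_mem[of k] q_mem[of k]]
        by (simp add: \<delta>_def inner_diff_right power2_norm_eq_inner)
      then have "0 \<le> k * (gap \<bullet> (\<delta> k - gap))" by simp
      then have "y k \<bullet> (\<delta> k - gap) \<le> C + e * k"
        using C[of k] by (simp add: y_def inner_diff_left)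
      moreover have "norm (\<delta> k - gap) \<le> norm (\<delta> 0) + norm gap"
        using norm_triangle_ineq4[of "\<delta> k" gap] norm_\<delta>_le[of k] by linarith
      then have "(norm (\<delta> k - gap))\<^sup>2 \<le> M"
        unfolding M_def by (intro power_mono) auto
      moreover have "e * (real (Suc k))\<^sup>2 = e * (real k)\<^sup>2 + 2 * (e * k) + e"
        by (simp add: power2_eq_square algebra_simps)
      ultimately show ?case using Suc that by (simp add: algebra_simps)
    qed
    then show ?thesis by blast
  qed
  have "(\<lambda>k. (norm (y k) / k)\<^sup>2) \<longlonglongrightarrow> 0"
  proof (rule order_tendstoI)
    fix \<epsilon> :: real assume "0 < \<epsilon>"
    then obtain C where C: "\<And>k. (norm (y k))\<^sup>2 \<le> (norm (z 0))\<^sup>2 + C * real k + \<epsilon> / 2 * (real k)\<^sup>2"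
      using quadratic[of "\<epsilon> / 2"] by auto
    have "(\<lambda>k. (norm (z 0))\<^sup>2 * (1 / real k) * (1 / real k) + C * (1 / real k) + \<epsilon> / 2)
        \<longlonglongrightarrow> (norm (z 0))\<^sup>2 * 0 * 0 + C * 0 + \<epsilon> / 2"
      by (intro tendsto_intros lim_1_over_n)
    from order_tendstoD(2)[OF this, of \<epsilon>] \<open>0 < \<epsilon>\<close> have "\<forall>\<^sub>F k in sequentially.
        (norm (z 0))\<^sup>2 * (1 / real k) * (1 / real k) + C * (1 / real k) + \<epsilon> / 2 < \<epsilon>"
      by simp
    then show "\<forall>\<^sub>F k in sequentially. (norm (y k) / k)\<^sup>2 < \<epsilon>"
      using eventually_gt_at_top[of 0]
    proof eventually_elim
      case (elim k)
      have "(norm (y k) / k)\<^sup>2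
          \<le> ((norm (z 0))\<^sup>2 + C * real k + \<epsilon> / 2 * (real k)\<^sup>2) / (real k)\<^sup>2"
        unfolding power_divide using C[of k] by (intro divide_right_mono) auto
      also have "\<dots> = (norm (z 0))\<^sup>2 * (1 / real k) * (1 / real k) + C * (1 / real k) + \<epsilon> / 2"
        using elim(2) by (simp add: field_simps power2_eq_square)
      finally show ?case using elim(1) by simp
    qed
  next
    fix \<epsilon> :: real assume "\<epsilon> < 0"
    then show "\<forall>\<^sub>F k in sequentially. \<epsilon> < (norm (y k) / k)\<^sup>2"
      by (intro always_eventually allI less_le_trans[OF _ zero_le_power2])
  qed
  then show ?thesis 
    using tendsto_real_sqrt by (fastforce simp: y_def)
qed

theorem norm_step_tendsto_setdist: "(\<lambda>k. norm (\<delta> k)) \<longlonglongrightarrow> setdist A B"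
proof -
  obtain L where L: "(\<lambda>k. norm (\<delta> k)) \<longlonglongrightarrow> L"
    using decseq_convergent[OF norm_\<delta>_decseq, of 0] by auto
  have "setdist A B \<le> norm (\<delta> k)" for k
    using setdist_le_dist[OF p_mem q_mem, of k k] by (simp add: \<delta>_def dist_norm norm_minus_commute)
  then have ge: "setdist A B \<le> L" using L LIMSEQ_le_const by blast
  have "L \<le> norm gap"
  proof (rule tendsto_lowerbound)
    show "(\<lambda>k. norm (z k - real k *\<^sub>R gap) / k + norm gap + norm (z 0) * (1 / real k))
        \<longlonglongrightarrow> norm gap"
      by (rule tendsto_eq_intros average_displacement_tendsto_gap lim_1_over_n refl | simp)+
    show "\<forall>\<^sub>F k in sequentially.
        L \<le> norm (z k - real k *\<^sub>R gap) / k + norm gap + norm (z 0) * (1 / real k)"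
      using eventually_gt_at_top[of 0]
    proof eventually_elim
      case (elim k)
      have "z k - z 0 = (z k - real k *\<^sub>R gap) + real k *\<^sub>R gap - z 0" by simp
      then have "norm (z k - z 0) \<le> norm (z k - real k *\<^sub>R gap) + k * norm gap + norm (z 0)"
        by (smt (verit) norm_triangle_ineq norm_triangle_ineq4 norm_scaleR of_nat_0_le_iff)
      with limit_le_average_speed[OF L, of k]
      have "k * L \<le> norm (z k - real k *\<^sub>R gap) + k * norm gap + norm (z 0)" by linarith
      then show ?case using elim by (simp add: field_simps)
    qed
  qed simp
  then have "L = setdist A B" using ge norm_gap_le_setdist by linarith
  with L show ?thesis by simp
qed

end

section \<open>Affine minorants from the dual problem\<close>

lemma conjugate_gt_minus_inf:
  assumes "proper_fun f"
  shows "conjugate f \<nu> \<noteq> -\<infinity>"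
proof -
  obtain x c where "f x = ereal c"
    using proper_fun_finite_value[OF assms] by blast
  then have "ereal (\<nu> \<bullet> x - c) \<le> conjugate f \<nu>"
    unfolding conjugate_def by (intro SUP_upper2[of x]) auto
  then show ?thesis by auto
qed

lemma conjugate_finite_minorant:
  assumes "proper_fun f" "conjugate f \<nu> \<noteq> \<infinity>"
  shows "\<exists>a. \<forall>x. ereal (\<nu> \<bullet> x - a) \<le> f x"
proof -
  obtain a where a: "conjugate f \<nu> = ereal a"
    using assms conjugate_gt_minus_inf[of f \<nu>] by (cases "conjugate f \<nu>") auto
  have "ereal (\<nu> \<bullet> x - a) \<le> f x" for x
  proof -
    have "ereal (\<nu> \<bullet> x) - f x \<le> ereal a"
      unfolding a[symmetric] conjugate_def by (rule SUP_upper) simp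
    then show ?thesis by (cases "f x") auto
  qed
  then show ?thesis by blast
qed

text \<open>
  Some dual point has positive value.  Both conjugates are finite there, because neither of them
  takes the value \<open>-\<infinity>\<close>.
\<close>

lemma dual_feasible_point:
  assumes "proper_fun f" "proper_fun g" "dual_value f g = \<infinity>"
  obtains \<nu> where "conjugate f \<nu> \<noteq> \<infinity>" "conjugate g (- \<nu>) \<noteq> \<infinity>"
proof -
  have "0 < (SUP \<nu>. - conjugate f \<nu> - conjugate g (- \<nu>))"
    using assms(3) by (simp add: dual_value_def)
  then obtain \<nu> where \<nu>: "0 < - conjugate f \<nu> - conjugate g (- \<nu>)"
    by (auto simp: less_SUP_iff)
  then have "conjugate f \<nu> \<noteq> \<infinity> \<and> conjugate g (- \<nu>) \<noteq> \<infinity>"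
    using conjugate_gt_minus_inf[OF assms(1), of \<nu>] conjugate_gt_minus_inf[OF assms(2), of "- \<nu>"]
    by (cases "conjugate f \<nu>"; cases "conjugate g (- \<nu>)") auto
  then show thesis using that by blast
qed

section \<open>Positive multiples and effective domains\<close>

lemma scaled_fun:
  fixes f :: "'a::real_normed_vector \<Rightarrow> ereal"
  assumes "0 < \<gamma>"
  shows never_minus_inf_scaled: "never_minus_inf f \<Longrightarrow> never_minus_inf (\<lambda>u. ereal \<gamma> * f u)"
    and proper_fun_scaled: "proper_fun f \<Longrightarrow> proper_fun (\<lambda>u. ereal \<gamma> * f u)"
    and closed_fun_scaled: "closed_fun f \<Longrightarrow> closed_fun (\<lambda>u. ereal \<gamma> * f u)"
    and convex_fun_scaled: "convex_fun f \<Longrightarrow> convex_fun (\<lambda>u. ereal \<gamma> * f u)"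
    and eff_dom_scaled: "eff_dom (\<lambda>u. ereal \<gamma> * f u) = eff_dom f"
proof -
  show "never_minus_inf (\<lambda>u. ereal \<gamma> * f u)" if "never_minus_inf f"
    using that assms by (auto simp: never_minus_inf_def)
  show "proper_fun (\<lambda>u. ereal \<gamma> * f u)" if f: "proper_fun f"
  proof -
    obtain x c where "f x = ereal c"
      using proper_fun_finite_value[OF f] by blast
    then show ?thesis unfolding proper_fun_def by (intro exI[of _ x]) simp
  qed
  have "(ereal \<gamma> * f x \<le> ereal t) = (f x \<le> ereal (t / \<gamma>))" for x t
    using assms by (cases "f x") (auto simp: field_simps)
  then have epi: "epi (\<lambda>u. ereal \<gamma> * f u) = (\<lambda>(x, t). (x, t / \<gamma>)) -` epi f"
    by (auto simp: epi_def)
  show "closed_fun (\<lambda>u. ereal \<gamma> * f u)" if "closed_fun f"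
    using that assms unfolding closed_fun_def epi case_prod_beta
    by (intro closed_vimage continuous_intros) auto
  show "convex_fun (\<lambda>u. ereal \<gamma> * f u)" if "convex_fun f"
    unfolding convex_fun_def
  proof (intro allI impI)
    fix x y :: 'a and u v :: real
    assume uv: "0 \<le> u" "0 \<le> v" "u + v = 1"
    have "ereal \<gamma> * f (u *\<^sub>R x + v *\<^sub>R y) \<le> ereal \<gamma> * (ereal u * f x + ereal v * f y)"
      using that uv assms unfolding convex_fun_def by (intro ereal_mult_left_mono) auto
    also have "\<dots> = ereal u * (ereal \<gamma> * f x) + ereal v * (ereal \<gamma> * f y)"
      using assms by (simp add: ereal_pos_distrib mult.left_commute)
    finally show "ereal \<gamma> * f (u *\<^sub>R x + v *\<^sub>R y)
        \<le> ereal u * (ereal \<gamma> * f x) + ereal v * (ereal \<gamma> * f y)" .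
  qed
  have "(ereal \<gamma> * f x < \<infinity>) = (f x < \<infinity>)" for x
    using assms by (cases "f x") auto
  then show "eff_dom (\<lambda>u. ereal \<gamma> * f u) = eff_dom f"
    by (simp add: eff_dom_def)
qed

lemma scaled_minorant:
  fixes f :: "'a::real_inner \<Rightarrow> ereal"
  assumes "0 < \<gamma>" "ereal (\<nu> \<bullet> x - a) \<le> f x"
  shows "ereal ((\<gamma> *\<^sub>R \<nu>) \<bullet> x - \<gamma> * a) \<le> ereal \<gamma> * f x"
  using ereal_mult_left_mono[OF assms(2), of "ereal \<gamma>"] assms(1) by (simp add: algebra_simps)

lemma convex_eff_dom:
  assumes "convex_fun f" "never_minus_inf f"
  shows "convex (eff_dom f)"
proof (rule convexI)
  fix x y u v
  assume xy: "x \<in> eff_dom f" "y \<in> eff_dom f" and uv: "0 \<le> (u::real)" "0 \<le> v" "u + v = 1"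
  obtain c d where "f x = ereal c" "f y = ereal d"
    using xy assms(2) unfolding eff_dom_def never_minus_inf_def
    by (metis mem_Collect_eq less_ereal.simps(4) ereal_cases less_irrefl)
  then have "f (u *\<^sub>R x + v *\<^sub>R y) \<le> ereal (u * c + v * d)"
    using assms(1)[unfolded convex_fun_def, rule_format, OF uv, of x y] by simp
  then show "u *\<^sub>R x + v *\<^sub>R y \<in> eff_dom f"
    by (auto simp: eff_dom_def less_top[symmetric] top_ereal_def)
qed

lemma real_minorant_on_eff_dom:
  assumes "never_minus_inf h" "x \<in> eff_dom h" "ereal c \<le> h x"
  shows "c \<le> real_of_ereal (h x)"
  using assms by (cases "h x") (auto simp: eff_dom_def never_minus_inf_def)

section \<open>Step lengths of Douglas--Rachford splitting\<close>

theorem theorem10: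
  fixes f g :: "real ^ 'n \<Rightarrow> ereal"
    and \<gamma> :: real
    and z0 :: "real ^ 'n"
    and xh x z :: "nat \<Rightarrow> real ^ 'n"
  assumes "never_minus_inf f" "closed_fun f" "proper_fun f" "convex_fun f"
    and "never_minus_inf g" "closed_fun g" "proper_fun g" "convex_fun g"
    and "\<gamma> > 0"
    and "drs_iterates f g \<gamma> z0 xh x z"
    and "dual_value f g = \<infinity>" "primal_value f g = \<infinity>"
    and "primal_infeasible f g"
  shows "(\<lambda>k. norm (x (Suc k) - xh k)) \<longlonglongrightarrow> setdist (eff_dom f) (eff_dom g)"
proof -
  let ?F = "\<lambda>u. ereal \<gamma> * f u" and ?G = "\<lambda>u. ereal \<gamma> * g u"
  obtain \<nu> where "conjugate f \<nu> \<noteq> \<infinity>" "conjugate g (- \<nu>) \<noteq> \<infinity>"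
    using dual_feasible_point assms by blast
  then obtain a b where "\<And>u. ereal (\<nu> \<bullet> u - a) \<le> f u" "\<And>u. ereal (- \<nu> \<bullet> u - b) \<le> g u"
    using conjugate_finite_minorant assms by metis
  then have minF: "\<And>u. ereal ((\<gamma> *\<^sub>R \<nu>) \<bullet> u - \<gamma> * a) \<le> ?F u"
    and minG: "\<And>u. ereal ((\<gamma> *\<^sub>R - \<nu>) \<bullet> u - \<gamma> * b) \<le> ?G u"
    using scaled_minorant[OF \<open>\<gamma> > 0\<close>] by blast+
  have F: "closed_fun ?F" "never_minus_inf ?F" "proper_fun ?F" "convex_fun ?F" "eff_dom ?F = eff_dom f"
    and G: "closed_fun ?G" "never_minus_inf ?G" "proper_fun ?G" "convex_fun ?G" "eff_dom ?G = eff_dom g"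
    using scaled_fun[OF \<open>\<gamma> > 0\<close>] assms by blast+
  note proxF = prox_variational_inequality[OF F(1-4) minF, unfolded F(5)]
    and proxG = prox_variational_inequality[OF G(1-4) minG, unfolded G(5)]
  have xh: "xh k = prox ?F (z k)" and x: "x (Suc k) = prox ?G (2 *\<^sub>R xh k - z k)"
    and z: "z (Suc k) = z k + x (Suc k) - xh k" for k
    using assms(10) unfolding drs_iterates_def by auto
  interpret splitting_orbit "eff_dom f" "eff_dom g" "\<lambda>u. real_of_ereal (?F u)"
    "\<lambda>u. real_of_ereal (?G u)" "\<gamma> *\<^sub>R \<nu>" "\<gamma> * a" "\<gamma> * b" z xh "\<lambda>k. x (Suc k)"
  proof
    show "convex (eff_dom f)" "convex (eff_dom g)"
      using convex_eff_dom assms by auto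
    show "xh k \<in> eff_dom f" "x (Suc k) \<in> eff_dom g" for k
      unfolding xh x by (rule proxF(1) proxG(1))+
    show "z (Suc k) = z k + (x (Suc k) - xh k)" for k
      by (simp add: z)
    show "real_of_ereal (?F (xh k)) + (z k - xh k) \<bullet> (u - xh k) \<le> real_of_ereal (?F u)"
      if "u \<in> eff_dom f" for k u
      using proxF(2)[OF that, of "z k"] by (simp only: xh)
    show "real_of_ereal (?G (x (Suc k))) + (2 *\<^sub>R xh k - z k - x (Suc k)) \<bullet> (w - x (Suc k))
        \<le> real_of_ereal (?G w)" if "w \<in> eff_dom g" for k w
      using proxG(2)[OF that, of "2 *\<^sub>R xh k - z k"] by (simp only: x)
    show "(\<gamma> *\<^sub>R \<nu>) \<bullet> u - \<gamma> * a \<le> real_of_ereal (?F u)" if "u \<in> eff_dom f" for u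
      using real_minorant_on_eff_dom[OF F(2) _ minF] that F(5) by blast
    show "- ((\<gamma> *\<^sub>R \<nu>) \<bullet> w) - \<gamma> * b \<le> real_of_ereal (?G w)" if "w \<in> eff_dom g" for w
      using real_minorant_on_eff_dom[OF G(2) _ minG, of w] that G(5) by simp
  qed
  show ?thesis
    using norm_step_tendsto_setdist unfolding \<delta>_def .
qed

end
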